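(* Let $R_1$ and $R_2$ be two finite rings such that $|Z(R_1)|=|Z(R_2)|$, and let $r\in K(R_1)$. If $(\phi,\psi)$ is an isoclinism between $R_1$ and $R_2$, then the graphs $\Gamma_{R_1}^{r}$ and $\Gamma_{R_2}^{\psi(r)}$ are isomorphic.
   Context: Rings are associative and not assumed to have a unity. $[x,y]:=xy-yx$, $K(R):=\{[x,y]:x,y\in R\}$, $[R,R]$ is the additive subgroup of $(R,+)$ generated by $K(R)$, and $Z(R)$ is the center of $R$. For $r\in R$, the $r$-noncommuting graph $\Gamma_R^r$ is the simple undirected graph with vertex set $R$ in which two distinct vertices $x,y$ are adjacent if and only if $[x,y]\neq r$ and $[x,y]\neq -r$. An isoclinism between rings $R_1$ and $R_2$ is a pair $(\phi,\psi)$ of additive group isomorphisms $\phi:R_1/Z(R_1)\to R_2/Z(R_2)$ and $\psi:[R_1,R_1]\to[R_2,R_2]$ such that $\psi([u,v])=[u',v']$ whenever $\phi(u+Z(R_1))=u'+Z(R_2)$ and $\phi(v+Z(R_1))=v'+Z(R_2)$. *)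

theory Defs
  imports
    "HOL-Algebra.AbelCoset"
    "HOL-Algebra.Generated_Groups"
    "Graph_Theory.Pair_Digraph"
    "Graph_Theory.Digraph_Isomorphism"
begin

text \<open>
  Rings are associative and need not have a unity, so the library locale \<^locale>\<open>ring\<close> is too
  strong. The \<open>one\<close> field of the ring record carries no meaning below.
\<close>

locale nonunital_ring = abelian_group R for R (structure) +
  assumes m_closed: "\<lbrakk>x \<in> carrier R; y \<in> carrier R\<rbrakk> \<Longrightarrow> x \<otimes> y \<in> carrier R"
    and m_assoc: "\<lbrakk>x \<in> carrier R; y \<in> carrier R; z \<in> carrier R\<rbrakk>
      \<Longrightarrow> (x \<otimes> y) \<otimes> z = x \<otimes> (y \<otimes> z)"
    and l_distr: "\<lbrakk>x \<in> carrier R; y \<in> carrier R; z \<in> carrier R\<rbrakk>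
      \<Longrightarrow> (x \<oplus> y) \<otimes> z = x \<otimes> z \<oplus> y \<otimes> z"
    and r_distr: "\<lbrakk>x \<in> carrier R; y \<in> carrier R; z \<in> carrier R\<rbrakk>
      \<Longrightarrow> z \<otimes> (x \<oplus> y) = z \<otimes> x \<oplus> z \<otimes> y"

definition ring_center :: "('a, 'm) ring_scheme \<Rightarrow> 'a set" where
  "ring_center R = {z \<in> carrier R. \<forall>x \<in> carrier R. z \<otimes>\<^bsub>R\<^esub> x = x \<otimes>\<^bsub>R\<^esub> z}"

definition commutator :: "('a, 'm) ring_scheme \<Rightarrow> 'a \<Rightarrow> 'a \<Rightarrow> 'a" where
  "commutator R x y = x \<otimes>\<^bsub>R\<^esub> y \<ominus>\<^bsub>R\<^esub> y \<otimes>\<^bsub>R\<^esub> x"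

definition commutator_set :: "('a, 'm) ring_scheme \<Rightarrow> 'a set" where
  "commutator_set R = {commutator R x y | x y. x \<in> carrier R \<and> y \<in> carrier R}"

definition commutator_group :: "('a, 'm) ring_scheme \<Rightarrow> ('a, 'm) monoid_scheme" where
  "commutator_group R =
    (add_monoid R)\<lparr>carrier := generate (add_monoid R) (commutator_set R)\<rparr>"

definition isoclinism ::
  "('a, 'm) ring_scheme \<Rightarrow> ('b, 'n) ring_scheme \<Rightarrow> ('a set \<Rightarrow> 'b set) \<Rightarrow> ('a \<Rightarrow> 'b) \<Rightarrow> bool"
where
  "isoclinism R S \<phi> \<psi> \<longleftrightarrow>
     \<phi> \<in> iso (R A_Mod ring_center R) (S A_Mod ring_center S) \<and>
     \<psi> \<in> iso (commutator_group R) (commutator_group S) \<and>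
     (\<forall>u \<in> carrier R. \<forall>v \<in> carrier R. \<forall>u' \<in> carrier S. \<forall>v' \<in> carrier S.
        \<phi> (ring_center R +>\<^bsub>R\<^esub> u) = ring_center S +>\<^bsub>S\<^esub> u' \<longrightarrow>
        \<phi> (ring_center R +>\<^bsub>R\<^esub> v) = ring_center S +>\<^bsub>S\<^esub> v' \<longrightarrow>
        \<psi> (commutator R u v) = commutator S u' v')"

text \<open>
  A simple undirected graph is represented, as in \<^locale>\<open>pair_graph\<close>, by a symmetric loop-free
  set of ordered pairs. Lemma \<open>pair_graph_noncommuting_graph\<close> below shows that the graph is of
  this kind, and \<open>digraph_iso_with_proj_iff\<close> that \<^const>\<open>digraph_iso\<close> is then the usual notion of
  graph isomorphism.
\<close>

definition noncommuting_graph :: "('a, 'm) ring_scheme \<Rightarrow> 'a \<Rightarrow> 'a pair_pre_digraph" where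
  "noncommuting_graph R r =
    \<lparr>pverts = carrier R,
     parcs = {(x, y). x \<in> carrier R \<and> y \<in> carrier R \<and> x \<noteq> y \<and>
                commutator R x y \<noteq> r \<and> commutator R x y \<noteq> \<ominus>\<^bsub>R\<^esub> r}\<rparr>"

context nonunital_ring
begin

lemma commutator_closed:
  "\<lbrakk>x \<in> carrier R; y \<in> carrier R\<rbrakk> \<Longrightarrow> commutator R x y \<in> carrier R"
  by (simp add: commutator_def m_closed)

lemma commutator_swap:
  "\<lbrakk>x \<in> carrier R; y \<in> carrier R\<rbrakk> \<Longrightarrow> commutator R y x = \<ominus> commutator R x y"
  by (simp add: commutator_def m_closed a_minus_def minus_add a_comm)

lemma pair_graph_noncommuting_graph:
  assumes "finite (carrier R)" and r: "r \<in> carrier R"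
  shows "pair_graph (noncommuting_graph R r)"
proof -
  have "finite {(x, y). x \<in> carrier R \<and> y \<in> carrier R \<and> x \<noteq> y \<and>
      commutator R x y \<noteq> r \<and> commutator R x y \<noteq> \<ominus> r}"
    by (rule finite_subset[of _ "carrier R \<times> carrier R"]) (use assms in auto)
  moreover have "commutator R y x \<noteq> r \<and> commutator R y x \<noteq> \<ominus> r"
    if "x \<in> carrier R" "y \<in> carrier R" "commutator R x y \<noteq> r" "commutator R x y \<noteq> \<ominus> r" for x y
    using that r commutator_closed[of x y] by (metis commutator_swap minus_minus)
  ultimately show ?thesis
    using assms by unfold_locales
      (auto simp: noncommuting_graph_def symmetric_def sym_def arcs_ends_def arc_to_ends_def)
qed

end

lemma digraph_iso_with_proj_iff:
  assumes "pair_graph G" and "pair_graph H"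
  shows "digraph_iso (with_proj G) (with_proj H) \<longleftrightarrow>
    (\<exists>f. bij_betw f (pverts G) (pverts H) \<and>
      (\<forall>x \<in> pverts G. \<forall>y \<in> pverts G. (x, y) \<in> parcs G \<longleftrightarrow> (f x, f y) \<in> parcs H))"
    (is "?L \<longleftrightarrow> ?R")
proof
  interpret G: pair_graph G by fact
  interpret H: pair_graph H by fact
  { assume ?L
    then obtain h where h: "pre_digraph.digraph_isomorphism (with_proj G) h"
      and H: "with_proj H = app_iso h (with_proj G)"
      unfolding digraph_iso_def by blast
    have V: "pverts H = iso_verts h ` pverts G" and A: "parcs H = iso_arcs h ` parcs G"
      and th: "iso_tail h = fst" "iso_head h = snd"
      using H by (auto simp: app_iso_def with_proj_def)
    have inj: "inj_on (iso_verts h) (pverts G)"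
      and ends: "\<And>a. a \<in> parcs G \<Longrightarrow>
        iso_arcs h a = (iso_verts h (fst a), iso_verts h (snd a))"
      using h th by (auto simp: pre_digraph.digraph_isomorphism_def prod_eq_iff)
    have "(x, y) \<in> parcs G \<longleftrightarrow> (iso_verts h x, iso_verts h y) \<in> parcs H"
      if "x \<in> pverts G" "y \<in> pverts G" for x y
    proof
      assume "(x, y) \<in> parcs G"
      then show "(iso_verts h x, iso_verts h y) \<in> parcs H"
        unfolding A using ends by (force simp: image_iff)
    next
      assume "(iso_verts h x, iso_verts h y) \<in> parcs H"
      then obtain a where a: "a \<in> parcs G"
        "(iso_verts h x, iso_verts h y) = (iso_verts h (fst a), iso_verts h (snd a))"
        unfolding A using ends by force
      then have "fst a = x" "snd a = y"
        using inj that G.arc_fst_in_verts G.arc_snd_in_verts by (auto dest: inj_onD)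
      then show "(x, y) \<in> parcs G" using a(1) by auto
    qed
    then show ?R using inj V by (auto simp: bij_betw_def) }
  { assume ?R
    then obtain f where f: "inj_on f (pverts G)" "f ` pverts G = pverts H"
      and e: "\<And>x y. \<lbrakk>x \<in> pverts G; y \<in> pverts G\<rbrakk> \<Longrightarrow> (x, y) \<in> parcs G \<longleftrightarrow> (f x, f y) \<in> parcs H"
      unfolding bij_betw_def by blast
    define h where "h = \<lparr>iso_verts = f, iso_arcs = map_prod f f, iso_head = snd, iso_tail = fst\<rparr>"
    have "inj_on (map_prod f f) (parcs G)"
      by (rule inj_on_subset[OF map_prod_inj_on[OF f(1) f(1)]])
        (auto dest: G.arc_fst_in_verts G.arc_snd_in_verts)
    moreover have "wf_digraph (with_proj G)"
      using G.pair_wf_digraph by (simp add: wf_digraph_wp_iff)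
    ultimately have "pre_digraph.digraph_isomorphism (with_proj G) h"
      using f(1) by (auto simp: pre_digraph.digraph_isomorphism_def h_def)
    moreover have "parcs H = map_prod f f ` parcs G"
    proof (intro equalityI subsetI)
      fix a assume a: "a \<in> parcs H"
      then have "fst a \<in> f ` pverts G" "snd a \<in> f ` pverts G"
        using H.arc_fst_in_verts H.arc_snd_in_verts f(2) by auto
      then obtain x y where "x \<in> pverts G" "y \<in> pverts G" "a = (f x, f y)"
        by (metis imageE prod.collapse)
      then show "a \<in> map_prod f f ` parcs G" using a e by force
    next
      fix a assume "a \<in> map_prod f f ` parcs G"
      then show "a \<in> parcs H"
        using e G.arc_fst_in_verts G.arc_snd_in_verts by fastforce
    qed
    then have "with_proj H = app_iso h (with_proj G)"
      using f(2) by (simp add: app_iso_def h_def with_proj_def)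
    ultimately show ?L unfolding digraph_iso_def by blast }
qed

end

theory Submission
  imports Defs
begin

text \<open>
  An additive isomorphism between the central quotients matches the cosets of the two centers,
  and all these cosets have the same cardinality. Choosing a bijection between each pair of
  matched cosets gives a bijection \<open>f\<close> between the rings that induces \<open>\<phi>\<close>, so that
  \<open>\<psi> [x, y] = [f x, f y]\<close>. As \<open>\<psi>\<close> is injective and respects negation of commutators,
  \<open>f\<close> is a graph isomorphism.
\<close>

text \<open>The fibres of \<open>p\<close> partition \<open>A\<close>, and those of \<open>q\<close>
  partition \<open>B\<close>. Matched fibres are finite and equinumerous, so bijections
  \<open>h c\<close> between them exist and glue together.\<close>

lemma bij_betw_lift_fibres:
  assumes fin: "finite A" "finite B"
    and g: "bij_betw g (p ` A) (q ` B)"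
    and card_eq: "\<And>c. c \<in> p ` A \<Longrightarrow> card {x \<in> A. p x = c} = card {y \<in> B. q y = g c}"
  obtains f where "bij_betw f A B" "\<And>x. x \<in> A \<Longrightarrow> q (f x) = g (p x)"
proof -
  have "\<exists>h. bij_betw h {x \<in> A. p x = c} {y \<in> B. q y = g c}" if "c \<in> p ` A" for c
    using fin card_eq[OF that] by (intro finite_same_card_bij) auto
  then obtain h where h: "\<And>c. c \<in> p ` A \<Longrightarrow> bij_betw (h c) {x \<in> A. p x = c} {y \<in> B. q y = g c}"
    by metis
  define f where "f x = h (p x) x" for x
  have f: "f x \<in> B \<and> q (f x) = g (p x)" if "x \<in> A" for x
    using bij_betwE[OF h[of "p x"]] that by (auto simp: f_def)
  have "inj_on f A"
  proof (rule inj_onI)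
    \<comment> \<open>A common value under \<open>f\<close> has one image under \<open>q\<close>, so
      injectivity of \<open>g\<close> puts \<open>x\<close> and \<open>y\<close> in the same fibre,
      where \<open>h (p x)\<close> is injective.\<close>
    fix x y assume xy: "x \<in> A" "y \<in> A" "f x = f y"
    then have "p x = p y"
      using f g by (metis bij_betw_imp_inj_on imageI inj_onD)
    then show "x = y"
      using xy bij_betw_imp_inj_on[OF h[of "p x"]] by (auto simp: f_def dest: inj_onD)
  qed
  moreover have "B \<subseteq> f ` A"
  proof
    fix y assume y: "y \<in> B"
    \<comment> \<open>Surjectivity of \<open>g\<close> finds the fibre of \<open>p\<close> that is
      matched with the fibre of \<open>y\<close>.\<close>
    then have "q y \<in> g ` p ` A"
      using bij_betw_imp_surj_on[OF g] by simp
    then obtain x where x: "x \<in> A" "q y = g (p x)" by blast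
    then have "y \<in> h (p x) ` {z \<in> A. p z = p x}"
      using bij_betw_imp_surj_on[OF h[OF imageI[OF x(1)]]] x(2) y by auto
    then obtain z where "z \<in> A" "p z = p x" "h (p x) z = y" by blast
    then show "y \<in> f ` A" by (metis f_def imageI)
  qed
  ultimately show ?thesis
    using that[of f] f by (auto simp: bij_betw_def)
qed

context nonunital_ring
begin

lemma l_null: "x \<in> carrier R \<Longrightarrow> \<zero> \<otimes> x = \<zero>"
  by (metis add.l_cancel_one add.one_closed l_distr m_closed l_zero)

lemma r_null: "x \<in> carrier R \<Longrightarrow> x \<otimes> \<zero> = \<zero>"
  by (metis add.l_cancel_one add.one_closed r_distr m_closed l_zero)

lemma l_minus: "\<lbrakk>x \<in> carrier R; y \<in> carrier R\<rbrakk> \<Longrightarrow> (\<ominus> x) \<otimes> y = \<ominus> (x \<otimes> y)"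
  by (metis a_inv_closed l_distr l_neg l_null m_closed minus_equality)

lemma r_minus: "\<lbrakk>x \<in> carrier R; y \<in> carrier R\<rbrakk> \<Longrightarrow> x \<otimes> (\<ominus> y) = \<ominus> (x \<otimes> y)"
  by (metis a_inv_closed r_distr l_neg r_null m_closed minus_equality)

lemma subgroup_ring_center: "subgroup (ring_center R) (add_monoid R)"
proof (rule add.subgroupI)
  show "ring_center R \<noteq> {}"
    using l_null r_null by (auto simp: ring_center_def)
qed (auto simp: ring_center_def l_distr r_distr l_minus r_minus simp flip: a_inv_def)

lemma carrier_A_Mod: "carrier (R A_Mod H) = (\<lambda>x. H +> x) ` carrier R"
  by (auto simp: A_FactGroup_def FactGroup_def RCOSETS_def a_r_coset_def)

text \<open>Cosets of a subgroup are disjoint or equal, so lying in a coset is the same as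
  generating it. This reduces counting fibres to counting cosets.\<close>

lemma a_coset_fibre:
  assumes H: "subgroup H (add_monoid R)" and c: "c \<in> (\<lambda>x. H +> x) ` carrier R"
  shows "{x \<in> carrier R. H +> x = c} = c"
proof -
  obtain a where a: "a \<in> carrier R" "c = H +> a" using c by blast
  have "x \<in> H +> a \<longleftrightarrow> H +> x = H +> a" if "x \<in> carrier R" for x
    using that a add.repr_independence[OF _ _ H] add.rcos_self[OF _ H]
    by (metis a_r_coset_def partial_object.select_convs(1))
  moreover have "H +> a \<subseteq> carrier R"
    using add.r_coset_subset_G[of H a] subgroup.subset[OF H] a by (simp add: a_r_coset_def)
  ultimately show ?thesis using a by auto
qed

lemma card_a_coset:
  assumes "subgroup H (add_monoid R)" and "c \<in> (\<lambda>x. H +> x) ` carrier R"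
  shows "card c = card H"
proof -
  have "c \<in> RCOSETS (add_monoid R) H"
    using assms(2) by (auto simp: RCOSETS_def a_r_coset_def)
  then show ?thesis
    using add.card_rcosets_equal[of c H] subgroup.subset[OF assms(1)] by (metis partial_object.select_convs(1))
qed

end

theorem proposition3p1:
  fixes R\<^sub>1 :: "('a, 'm) ring_scheme" and R\<^sub>2 :: "('b, 'n) ring_scheme"
    and \<phi> :: "'a set \<Rightarrow> 'b set" and \<psi> :: "'a \<Rightarrow> 'b" and r :: 'a
  assumes "nonunital_ring R\<^sub>1" and "nonunital_ring R\<^sub>2"
    and "finite (carrier R\<^sub>1)" and "finite (carrier R\<^sub>2)"
    and "card (ring_center R\<^sub>1) = card (ring_center R\<^sub>2)"
    and "r \<in> commutator_set R\<^sub>1"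
    and "isoclinism R\<^sub>1 R\<^sub>2 \<phi> \<psi>"
  shows "digraph_iso (with_proj (noncommuting_graph R\<^sub>1 r))
                     (with_proj (noncommuting_graph R\<^sub>2 (\<psi> r)))"
proof -
  interpret R1: nonunital_ring R\<^sub>1 by fact
  interpret R2: nonunital_ring R\<^sub>2 by fact
  let ?p = "\<lambda>x. ring_center R\<^sub>1 +>\<^bsub>R\<^sub>1\<^esub> x" and ?q = "\<lambda>y. ring_center R\<^sub>2 +>\<^bsub>R\<^sub>2\<^esub> y"
  have \<phi>: "bij_betw \<phi> (?p ` carrier R\<^sub>1) (?q ` carrier R\<^sub>2)"
    using assms(7) by (simp add: isoclinism_def iso_def R1.carrier_A_Mod R2.carrier_A_Mod)
  have card_eq: "card {x \<in> carrier R\<^sub>1. ?p x = c} = card {y \<in> carrier R\<^sub>2. ?q y = \<phi> c}"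
    if c: "c \<in> ?p ` carrier R\<^sub>1" for c
  proof -
    have \<phi>c: "\<phi> c \<in> ?q ` carrier R\<^sub>2"
      using bij_betwE[OF \<phi>] c by blast
    \<comment> \<open>Both fibres are cosets, hence as large as the respective centers, which have
      equal cardinality.\<close>
    show ?thesis
      unfolding R1.a_coset_fibre[OF R1.subgroup_ring_center c]
        R2.a_coset_fibre[OF R2.subgroup_ring_center \<phi>c]
      using assms(5) R1.card_a_coset[OF R1.subgroup_ring_center c]
        R2.card_a_coset[OF R2.subgroup_ring_center \<phi>c] by simp
  qed
  obtain f where f: "bij_betw f (carrier R\<^sub>1) (carrier R\<^sub>2)"
    and f\<phi>: "\<And>x. x \<in> carrier R\<^sub>1 \<Longrightarrow> ?q (f x) = \<phi> (?p x)"
    using bij_betw_lift_fibres[OF assms(3,4) \<phi> card_eq] by blast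
  have f_closed: "f x \<in> carrier R\<^sub>2" if "x \<in> carrier R\<^sub>1" for x
    using bij_betwE[OF f] that by blast
  \<comment> \<open>By \<open>f\<phi>\<close>, \<open>f x\<close> and \<open>f y\<close> represent
    the images under \<open>\<phi>\<close> of the cosets of \<open>x\<close> and \<open>y\<close>,
    so they can serve as \<open>u'\<close> and \<open>v'\<close> in the isoclinism
    condition.\<close>
  have \<psi>: "\<psi> (commutator R\<^sub>1 x y) = commutator R\<^sub>2 (f x) (f y)"
    if "x \<in> carrier R\<^sub>1" "y \<in> carrier R\<^sub>1" for x y
    using assms(7) f\<phi> f_closed that unfolding isoclinism_def by metis
  have "inj_on \<psi> (generate (add_monoid R\<^sub>1) (commutator_set R\<^sub>1))"
    using assms(7) by (auto simp: isoclinism_def iso_def commutator_group_def bij_betw_def)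
  then have \<psi>_inj: "inj_on \<psi> (commutator_set R\<^sub>1)"
    by (rule inj_on_subset) (auto intro: generate.incl)
  obtain a b where ab: "a \<in> carrier R\<^sub>1" "b \<in> carrier R\<^sub>1" "r = commutator R\<^sub>1 a b"
    using assms(6) by (auto simp: commutator_set_def)
  have r: "r \<in> carrier R\<^sub>1" "\<psi> r \<in> carrier R\<^sub>2"
    using ab \<psi> f_closed by (simp_all add: R1.commutator_closed R2.commutator_closed)
  have minus_r: "\<ominus>\<^bsub>R\<^sub>1\<^esub> r \<in> commutator_set R\<^sub>1" "\<psi> (\<ominus>\<^bsub>R\<^sub>1\<^esub> r) = \<ominus>\<^bsub>R\<^sub>2\<^esub> \<psi> r"
  proof -
    \<comment> \<open>Swapping the arguments negates a commutator. Thus the negative of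
      \<open>r\<close> is again a commutator, and \<open>\<psi>\<close> sends it to
      \<open>commutator R\<^sub>2 (f b) (f a)\<close>, the negative of
      \<open>\<psi> r\<close>.\<close>
    have eq: "\<ominus>\<^bsub>R\<^sub>1\<^esub> r = commutator R\<^sub>1 b a"
      using ab R1.commutator_swap[of a b] by simp
    then show "\<ominus>\<^bsub>R\<^sub>1\<^esub> r \<in> commutator_set R\<^sub>1"
      using ab by (auto simp: commutator_set_def)
    show "\<psi> (\<ominus>\<^bsub>R\<^sub>1\<^esub> r) = \<ominus>\<^bsub>R\<^sub>2\<^esub> \<psi> r"
      unfolding eq using ab \<psi> f_closed R2.commutator_swap[of "f a" "f b"] by simp
  qed
  have comm_iff: "commutator R\<^sub>2 (f x) (f y) = \<psi> s \<longleftrightarrow> commutator R\<^sub>1 x y = s"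
    if "x \<in> carrier R\<^sub>1" "y \<in> carrier R\<^sub>1" "s \<in> commutator_set R\<^sub>1" for x y s
  proof -
    have "commutator R\<^sub>1 x y \<in> commutator_set R\<^sub>1"
      using that by (auto simp: commutator_set_def)
    then show ?thesis
      \<comment> \<open>Reading \<open>\<psi>\<close> backwards turns the left side into an equality
        of two values of \<open>\<psi>\<close> on commutators.\<close>
      using \<psi>_inj that by (simp add: inj_on_eq_iff flip: \<psi>)
  qed
  have "(x, y) \<in> parcs (noncommuting_graph R\<^sub>1 r) \<longleftrightarrow>
      (f x, f y) \<in> parcs (noncommuting_graph R\<^sub>2 (\<psi> r))"
    if "x \<in> carrier R\<^sub>1" "y \<in> carrier R\<^sub>1" for x y
    \<comment> \<open>The two forbidden values are the cases \<open>s = r\<close> and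
      \<open>s\<close> the negative of \<open>r\<close> of \<open>comm_iff\<close>; injectivity of
      \<open>f\<close> handles \<open>x \<noteq> y\<close>.\<close>
    using that f_closed comm_iff[OF that assms(6)] comm_iff[OF that minus_r(1)] minus_r(2)
      inj_on_eq_iff[OF bij_betw_imp_inj_on[OF f] that]
    by (simp add: noncommuting_graph_def)
  then show ?thesis
    using f R1.pair_graph_noncommuting_graph R2.pair_graph_noncommuting_graph assms(3,4) r
    by (subst digraph_iso_with_proj_iff) (auto simp: noncommuting_graph_def)
qed

end
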